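(* Let $G=(V,E)$ be a finite graph (multiple edges and loops allowed) with vertex set $V=\{v_1,\dots,v_n\}$, and let $L=\{l_i\}_{i\in V}$ be a family of finite lists, i.e. finite subsets $l_i\subseteq\mathcal{L}$ of some ground set $\mathcal{L}$, with $l_i$ assigned to $v_i$. Let $P(G,L)$ be the list-chromatic polynomial of $(G,L)$. Then the evaluation of $P(G,L)$ obtained by substituting $x_l=|l|$ for every indeterminate $x_l$ ($l\subseteq\mathcal{L}$) equals the number of list colorings of $G$ from the lists $L$, i.e. the number of maps $c:V\to\mathcal{L}$ with $c(v_i)\in l_i$ for all $i$ and $c(u)\neq c(w)$ whenever $u$ and $w$ are joined by an edge (in particular the count is $0$ if $G$ has a loop).
   Context: List-chromatic polynomial: for each subset $l\subseteq\mathcal{L}$ introduce a commuting indeterminate $x_l$. Then $$P(G,L)=\sum_{A\subseteq E}(-1)^{|A|}\,x_{c_1}x_{c_2}\cdots x_{c_{k(A)}},$$ where $k(A)$ is the number of connected components of the spanning subgraph $(V,A)$ and $c_j$ is the intersection of the lists $l_i$ of all vertices $v_i$ in the $j$-th connected component of $(V,A)$. Equivalently, $P$ is determined by the recursion: $P(G,L)=P(G-e,L)-P(G/e,L'')$ for a non-loop edge $e$, where $G-e$ deletes $e$ and $G/e$ contracts $e$ with the merged vertex receiving the intersection of the lists at the two endpoints of $e$ (other lists unchanged), giving list family $L''$; $P(G,L)=0$ if $G$ has a loop; and $P(G,L)=\prod_{i=1}^n x_{l_i}$ if $G$ has no edges. *)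

theory Defs
  imports "HOL-Library.Poly_Mapping" "HOL-Library.FuncSet"
begin

text \<open>A finite multigraph: \<open>ends e\<close> is the set of endpoints of the edge \<open>e\<close>, so a loop is an
  edge with a one-element set of endpoints.\<close>

locale finite_multigraph =
  fixes V :: "'v set" and E :: "'e set" and ends :: "'e \<Rightarrow> 'v set"
  assumes finite_V: "finite V"
    and finite_E: "finite E"
    and ends_in_V: "e \<in> E \<Longrightarrow> ends e \<subseteq> V"
    and card_ends: "e \<in> E \<Longrightarrow> card (ends e) = 1 \<or> card (ends e) = 2"

text \<open>Vertices joined by an edge of \<open>A\<close>; the pair \<open>(u, u)\<close> is included iff \<open>A\<close> has a loop at \<open>u\<close>.\<close>

definition joined :: "('e \<Rightarrow> 'v set) \<Rightarrow> 'e set \<Rightarrow> ('v \<times> 'v) set" where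
  "joined ends A = {(u, w). \<exists>e\<in>A. ends e = {u, w}}"

definition components :: "'v set \<Rightarrow> ('e \<Rightarrow> 'v set) \<Rightarrow> 'e set \<Rightarrow> 'v set set" where
  "components V ends A = V // {(u, w) \<in> V \<times> V. (u, w) \<in> (joined ends A)\<^sup>*}"

text \<open>Polynomials over \<open>'a\<close> in commuting indeterminates indexed by \<open>'i\<close>: finitely supported maps
  from exponent vectors to coefficients, with the convolution product of
  \<^theory>\<open>HOL-Library.Poly_Mapping\<close>.\<close>

type_synonym ('i, 'a) mpoly = "('i \<Rightarrow>\<^sub>0 nat) \<Rightarrow>\<^sub>0 'a"

definition indet :: "'i \<Rightarrow> ('i, 'a::comm_semiring_1) mpoly" where
  "indet i = Poly_Mapping.single (Poly_Mapping.single i 1) 1"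

definition eval_mpoly :: "('i \<Rightarrow> 'a) \<Rightarrow> ('i, 'a::comm_semiring_1) mpoly \<Rightarrow> 'a" where
  "eval_mpoly f p =
     (\<Sum>m\<in>Poly_Mapping.keys p.
        Poly_Mapping.lookup p m *
        (\<Prod>i\<in>Poly_Mapping.keys m. f i ^ Poly_Mapping.lookup m i))"

text \<open>The indeterminates are indexed by all sets of colours; only subsets of the ground set containing
  the lists occur in the polynomial, since connected components are nonempty.\<close>

definition list_chromatic_poly ::
    "'v set \<Rightarrow> 'e set \<Rightarrow> ('e \<Rightarrow> 'v set) \<Rightarrow> ('v \<Rightarrow> 'c set) \<Rightarrow> ('c set, int) mpoly" where
  "list_chromatic_poly V E ends L =
     (\<Sum>A\<in>Pow E. (-1) ^ card A * (\<Prod>C\<in>components V ends A. indet (\<Inter>v\<in>C. L v)))"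

text \<open>Colourings are taken extensional (\<open>undefined\<close> outside \<open>V\<close>), so that each map
  \<open>V \<rightarrow> \<L>\<close> is counted exactly once.\<close>

definition list_colorings ::
    "'v set \<Rightarrow> 'e set \<Rightarrow> ('e \<Rightarrow> 'v set) \<Rightarrow> 'c set \<Rightarrow> ('v \<Rightarrow> 'c set) \<Rightarrow> ('v \<Rightarrow> 'c) set" where
  "list_colorings V E ends \<L> L =
     {c \<in> V \<rightarrow>\<^sub>E \<L>. (\<forall>v\<in>V. c v \<in> L v) \<and> (\<forall>(u, w)\<in>joined ends E. c u \<noteq> c w)}"

end

theory Submission imports Defs begin

text \<open>After the substitution, the summand of an edge set \<open>A\<close> is, up to its sign, the number of
  colourings from the lists that are constant on every component of \<open>(V, A)\<close>, since the colours
  available to a component are those in the intersection of its lists. These are the colourings in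
  which every edge of \<open>A\<close> is monochromatic, so the alternating sum is inclusion-exclusion over the
  sets of monochromatic edges.\<close>

section \<open>Evaluation of polynomials\<close>

definition eval_monom :: "('i \<Rightarrow> 'a::comm_semiring_1) \<Rightarrow> ('i \<Rightarrow>\<^sub>0 nat) \<Rightarrow> 'a" where
  "eval_monom f m = (\<Prod>i\<in>Poly_Mapping.keys m. f i ^ Poly_Mapping.lookup m i)"

text \<open>The extra factors are \<open>f i ^ 0 = 1\<close>. Monomials with different keys can thus
  be compared over one common index set, and no case distinction on which indeterminates occur is
  needed.\<close>

lemma eval_monom_superset:
  assumes "finite S" "Poly_Mapping.keys m \<subseteq> S"
  shows "eval_monom f m = (\<Prod>i\<in>S. f i ^ Poly_Mapping.lookup m i)"
  unfolding eval_monom_def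
  using assms by (intro prod.mono_neutral_left) (auto simp: in_keys_iff)

lemma eval_monom_add: "eval_monom f (m + n) = eval_monom f m * eval_monom f n"
proof -
  let ?S = "Poly_Mapping.keys m \<union> Poly_Mapping.keys n"
  have "eval_monom f (m + n) = (\<Prod>i\<in>?S. f i ^ Poly_Mapping.lookup (m + n) i)"
    by (intro eval_monom_superset) (auto dest: subsetD[OF Poly_Mapping.keys_add])
  also have "\<dots> = (\<Prod>i\<in>?S. f i ^ Poly_Mapping.lookup m i) * (\<Prod>i\<in>?S. f i ^ Poly_Mapping.lookup n i)"
    by (simp add: lookup_add power_add prod.distrib)
  also have "\<dots> = eval_monom f m * eval_monom f n"
    by (simp add: eval_monom_superset[of ?S])
  finally show ?thesis .
qed

lemma eval_mpoly_superset:
  assumes "finite S" "Poly_Mapping.keys p \<subseteq> S"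
  shows "eval_mpoly f p = (\<Sum>m\<in>S. Poly_Mapping.lookup p m * eval_monom f m)"
  unfolding eval_mpoly_def eval_monom_def
  using assms by (intro sum.mono_neutral_left) (auto simp: in_keys_iff)

lemma eval_mpoly_add: "eval_mpoly f (p + q) = eval_mpoly f p + eval_mpoly f q"
proof -
  let ?S = "Poly_Mapping.keys p \<union> Poly_Mapping.keys q"
  have "eval_mpoly f (p + q) = (\<Sum>m\<in>?S. Poly_Mapping.lookup (p + q) m * eval_monom f m)"
    by (intro eval_mpoly_superset) (auto dest: subsetD[OF Poly_Mapping.keys_add])
  also have "\<dots> = (\<Sum>m\<in>?S. Poly_Mapping.lookup p m * eval_monom f m)
      + (\<Sum>m\<in>?S. Poly_Mapping.lookup q m * eval_monom f m)"
    by (simp add: lookup_add distrib_right sum.distrib)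
  also have "\<dots> = eval_mpoly f p + eval_mpoly f q"
    by (simp add: eval_mpoly_superset[of ?S])
  finally show ?thesis .
qed

lemma eval_mpoly_0 [simp]: "eval_mpoly f 0 = 0"
  by (simp add: eval_mpoly_def)

lemma eval_mpoly_single: "eval_mpoly f (Poly_Mapping.single m a) = a * eval_monom f m"
  by (subst eval_mpoly_superset[of "{m}"]) auto

lemma eval_mpoly_1 [simp]: "eval_mpoly f 1 = 1"
  unfolding single_one[symmetric] eval_mpoly_single by (simp add: eval_monom_def)

lemma eval_mpoly_indet [simp]: "eval_mpoly f (indet i) = f i"
  by (simp add: indet_def eval_mpoly_single eval_monom_def)

text \<open>Links \<open>update_induct\<close>, which builds a polynomial by updates at fresh keys,
  to additivity: each update adds one term.\<close>

lemma update_eq_single_add: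
  assumes "a \<notin> Poly_Mapping.keys p"
  shows "Poly_Mapping.update a b p = Poly_Mapping.single a b + p"
  using assms
  by (intro poly_mapping_eqI) (auto simp: lookup_update lookup_add lookup_single in_keys_iff)

text \<open>By distributivity it is enough to multiply two single terms, where exponents add and
  \<open>eval_monom_add\<close> applies. The outer induction splits \<open>p\<close> into terms, the
  inner one splits \<open>q\<close>.\<close>

lemma eval_mpoly_mult: "eval_mpoly f (p * q) = eval_mpoly f p * eval_mpoly f q"
proof (induction p rule: update_induct)
  case const
  show ?case by simp
next
  case (update p m a)
  have "eval_mpoly f (Poly_Mapping.single m a * q) = a * eval_monom f m * eval_mpoly f q"
  proof (induction q rule: update_induct)
    case const
    show ?case by simp
  next
    case (update q n b)
    then show ?case
      by (simp add: update_eq_single_add distrib_left eval_mpoly_add mult_single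
          eval_mpoly_single eval_monom_add mult_ac)
  qed
  with update show ?case
    by (simp add: update_eq_single_add distrib_right eval_mpoly_add eval_mpoly_single)
qed

lemma eval_mpoly_sum: "eval_mpoly f (\<Sum>x\<in>S. p x) = (\<Sum>x\<in>S. eval_mpoly f (p x))"
  by (induction S rule: infinite_finite_induct) (simp_all add: eval_mpoly_add)

lemma eval_mpoly_prod: "eval_mpoly f (\<Prod>x\<in>S. p x) = (\<Prod>x\<in>S. eval_mpoly f (p x))"
  by (induction S rule: infinite_finite_induct) (simp_all add: eval_mpoly_mult)

lemma eval_mpoly_minus:
  fixes f :: "'i \<Rightarrow> 'a::comm_ring_1"
  shows "eval_mpoly f (- p) = - eval_mpoly f p"
  using eval_mpoly_add[of f p "- p"] by (simp add: eq_neg_iff_add_eq_0 add.commute)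

lemma eval_mpoly_sign:
  fixes f :: "'i \<Rightarrow> 'a::comm_ring_1"
  shows "eval_mpoly f ((- 1) ^ n) = (- 1) ^ n"
  by (induction n) (simp_all add: eval_mpoly_minus)

section \<open>Colourings constant on classes\<close>

text \<open>A map constant on classes is a map on the quotient, and its value on a class must lie in
  the list of every member, hence in their intersection. Values on distinct classes are chosen
  independently.\<close>

lemma card_PiE_quotient:
  assumes "finite V" and r: "equiv V r"
  shows "card {c \<in> Pi\<^sub>E V L. \<forall>(u, w)\<in>r. c u = c w} = (\<Prod>C\<in>V // r. card (\<Inter>v\<in>C. L v))"
proof -
  have class_eq: "C = r `` {v}" if "C \<in> V // r" "v \<in> C" for C v
    using quotientE[OF that(1)] that(2) r by (metis Image_singleton_iff equiv_class_eq)
  have class_subset: "C \<subseteq> V" if "C \<in> V // r" for C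
    using that r by (metis Sup_upper Union_quotient)
  have class_ne: "C \<noteq> {}" if "C \<in> V // r" for C
    using that r in_quotient_imp_non_empty by blast
  have class_in: "r `` {v} \<in> V // r" "v \<in> r `` {v}" if "v \<in> V" for v
    using quotientI[OF that] equiv_class_self[OF r that] by auto
  have "bij_betw (\<lambda>g. \<lambda>v\<in>V. g (r `` {v})) (\<Pi>\<^sub>E C\<in>V // r. \<Inter>v\<in>C. L v)
      {c \<in> Pi\<^sub>E V L. \<forall>(u, w)\<in>r. c u = c w}"
  \<comment> \<open>The inverse reads off the colour of an arbitrary representative; the choice is
    immaterial because \<open>c\<close> is constant on the class.\<close>
  proof (rule bij_betwI[where g = "\<lambda>c. \<lambda>C\<in>V // r. c (SOME v. v \<in> C)"])
    show "(\<lambda>g. \<lambda>v\<in>V. g (r `` {v})) \<in> (\<Pi>\<^sub>E C\<in>V // r. \<Inter>v\<in>C. L v) \<rightarrow>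
        {c \<in> Pi\<^sub>E V L. \<forall>(u, w)\<in>r. c u = c w}"
    proof
      fix g assume g: "g \<in> (\<Pi>\<^sub>E C\<in>V // r. \<Inter>v\<in>C. L v)"
      have "g (r `` {v}) \<in> L v" if "v \<in> V" for v
        using PiE_mem[OF g class_in(1)[OF that]] class_in(2)[OF that] by blast
      moreover have "u \<in> V \<and> w \<in> V \<and> r `` {u} = r `` {w}" if "(u, w) \<in> r" for u w
        using that r by (metis equiv_class_eq_iff)
      ultimately show "(\<lambda>v\<in>V. g (r `` {v})) \<in> {c \<in> Pi\<^sub>E V L. \<forall>(u, w)\<in>r. c u = c w}"
        by auto
    qed
    show "(\<lambda>c. \<lambda>C\<in>V // r. c (SOME v. v \<in> C)) \<in> {c \<in> Pi\<^sub>E V L. \<forall>(u, w)\<in>r. c u = c w} \<rightarrow>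
        (\<Pi>\<^sub>E C\<in>V // r. \<Inter>v\<in>C. L v)"
    proof
      fix c assume c: "c \<in> {c \<in> Pi\<^sub>E V L. \<forall>(u, w)\<in>r. c u = c w}"
      have "c (SOME u. u \<in> C) \<in> L v" if "C \<in> V // r" "v \<in> C" for C v
      proof -
        have "(v, SOME u. u \<in> C) \<in> r"
          using class_eq[OF that] someI[of "\<lambda>u. u \<in> C", OF that(2)] by blast
        then have "c v = c (SOME u. u \<in> C)"
          using c by blast
        moreover have "c v \<in> L v"
          using c class_subset[OF that(1)] that(2) by blast
        ultimately show ?thesis by simp
      qed
      then show "(\<lambda>C\<in>V // r. c (SOME v. v \<in> C)) \<in> (\<Pi>\<^sub>E C\<in>V // r. \<Inter>v\<in>C. L v)"
        by auto
    qed
    show "(\<lambda>C\<in>V // r. (\<lambda>v\<in>V. g (r `` {v})) (SOME v. v \<in> C)) = g"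
      if g: "g \<in> (\<Pi>\<^sub>E C\<in>V // r. \<Inter>v\<in>C. L v)" for g
    proof (rule extensionalityI[of _ "V // r"])
      fix C assume C: "C \<in> V // r"
      \<comment> \<open>Classes are nonempty, so the chosen representative really lies in
        \<open>C\<close> and its class is \<open>C\<close> again.\<close>
      then have "(SOME v. v \<in> C) \<in> C" using class_ne some_in_eq by blast
      with C class_eq[OF C] class_subset[OF C] show
        "(\<lambda>C\<in>V // r. (\<lambda>v\<in>V. g (r `` {v})) (SOME v. v \<in> C)) C = g C"
        by (metis (no_types, lifting) restrict_apply' subsetD)
    qed (use g in \<open>auto simp: PiE_def\<close>)
    show "(\<lambda>v\<in>V. (\<lambda>C\<in>V // r. c (SOME v. v \<in> C)) (r `` {v})) = c"
      if c: "c \<in> {c \<in> Pi\<^sub>E V L. \<forall>(u, w)\<in>r. c u = c w}" for c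
    proof (rule extensionalityI[of _ V])
      fix v assume v: "v \<in> V"
      have "(SOME u. u \<in> r `` {v}) \<in> r `` {v}"
        using class_in(2)[OF v] by (rule someI)
      with c v class_in show "(\<lambda>v\<in>V. (\<lambda>C\<in>V // r. c (SOME v. v \<in> C)) (r `` {v})) v = c v"
        by auto
    qed (use c in \<open>auto simp: PiE_def\<close>)
  qed
  then have "card {c \<in> Pi\<^sub>E V L. \<forall>(u, w)\<in>r. c u = c w} = card (\<Pi>\<^sub>E C\<in>V // r. \<Inter>v\<in>C. L v)"
    by (simp add: bij_betw_same_card)
  then show ?thesis
    using assms by (simp add: card_PiE finite_quotient equiv_type)
qed

context finite_multigraph
begin

lemma finite_edge_subset: "A \<subseteq> E \<Longrightarrow> finite A"
  using finite_E finite_subset by blast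

lemma joined_subset: "A \<subseteq> E \<Longrightarrow> joined ends A \<subseteq> V \<times> V"
  using ends_in_V by (fastforce simp: joined_def)

text \<open>Symmetry holds because endpoints form an unordered pair, and it passes to the closure.
  The closure is reflexive on the whole type, so it is cut down to \<open>V\<close>; an isolated
  vertex becomes a class of its own.\<close>

lemma equiv_connected: "equiv V {(u, w) \<in> V \<times> V. (u, w) \<in> (joined ends A)\<^sup>*}"
proof -
  have "sym (joined ends A)"
    by (auto simp: joined_def sym_def insert_commute)
  then have "sym ((joined ends A)\<^sup>*)"
    by (rule sym_rtrancl)
  then show ?thesis
    by (auto simp: equiv_def refl_on_def sym_def trans_def intro: rtrancl_trans)
qed

text \<open>Equality of colours propagates along paths. Conversely, \<open>A \<subseteq> E\<close>
  keeps joined pairs inside \<open>V\<close>, so they survive the restriction to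
  \<open>V \<times> V\<close>.\<close>

lemma constant_on_connected_iff:
  assumes "A \<subseteq> E"
  shows "(\<forall>(u, w)\<in>{(u, w) \<in> V \<times> V. (u, w) \<in> (joined ends A)\<^sup>*}. c u = c w)
    \<longleftrightarrow> (\<forall>(u, w)\<in>joined ends A. c u = c w)"
proof
  assume "\<forall>(u, w)\<in>{(u, w) \<in> V \<times> V. (u, w) \<in> (joined ends A)\<^sup>*}. c u = c w"
  with joined_subset[OF assms] show "\<forall>(u, w)\<in>joined ends A. c u = c w"
    by blast
next
  assume const: "\<forall>(u, w)\<in>joined ends A. c u = c w"
  have "c u = c w" if "(u, w) \<in> (joined ends A)\<^sup>*" for u w
    using that by (induction rule: rtrancl_induct) (use const in auto)
  then show "\<forall>(u, w)\<in>{(u, w) \<in> V \<times> V. (u, w) \<in> (joined ends A)\<^sup>*}. c u = c w"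
    by auto
qed

lemma card_constant_on_joined:
  assumes "A \<subseteq> E"
  shows "card {c \<in> Pi\<^sub>E V L. \<forall>(u, w)\<in>joined ends A. c u = c w}
    = (\<Prod>C\<in>components V ends A. card (\<Inter>v\<in>C. L v))"
  using card_PiE_quotient[OF finite_V equiv_connected[of A], of L]
  unfolding constant_on_connected_iff[OF assms] components_def .

section \<open>Inclusion-exclusion over monochromatic edges\<close>

text \<open>A loop satisfies this for every \<open>c\<close>, since its only representation has
  \<open>u = w\<close>; this is why a graph with a loop gets count 0.\<close>

definition monochromatic :: "('v \<Rightarrow> 'c) \<Rightarrow> 'e \<Rightarrow> bool" where
  "monochromatic c e \<longleftrightarrow> (\<forall>u w. ends e = {u, w} \<longrightarrow> c u = c w)"

lemma constant_on_joined_iff: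
  "(\<forall>(u, w)\<in>joined ends A. c u = c w) \<longleftrightarrow> (\<forall>e\<in>A. monochromatic c e)"
  by (auto simp: joined_def monochromatic_def)

lemma proper_on_joined_iff:
  "(\<forall>(u, w)\<in>joined ends E. c u \<noteq> c w) \<longleftrightarrow> (\<forall>e\<in>E. \<not> monochromatic c e)"
proof -
  \<comment> \<open>Without such a representation an edge would be vacuously monochromatic while
    contributing no pair to \<open>joined\<close>.\<close>
  have "\<exists>u w. ends e = {u, w}" if "e \<in> E" for e
    using card_ends[OF that] by (auto simp: card_1_singleton_iff card_2_iff)
  then show ?thesis
    by (fastforce simp: joined_def monochromatic_def doubleton_eq_iff)
qed

text \<open>For a fixed colouring the signed sum over \<open>A\<close> factors into one factor per
  edge, which is 0 if the edge is monochromatic and 1 otherwise. Only colourings without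
  monochromatic edges survive.\<close>

lemma alternating_sum_constant_on_joined:
  assumes "finite S"
  shows "(\<Sum>A\<in>Pow E. (- 1) ^ card A * int (card {c \<in> S. \<forall>(u, w)\<in>joined ends A. c u = c w}))
    = int (card {c \<in> S. \<forall>(u, w)\<in>joined ends E. c u \<noteq> c w})"
proof -
  have count: "int (card {c \<in> S. P c}) = (\<Sum>c\<in>S. of_bool (P c))" for P
    using assms by (simp add: Int_def)
  have all: "(\<Prod>e\<in>A. of_bool (P e)) = (of_bool (\<forall>e\<in>A. P e) :: int)" if "finite A" for A and P :: "'e \<Rightarrow> bool"
    using that by (induction A) auto
  have "(\<Sum>A\<in>Pow E. (- 1) ^ card A * int (card {c \<in> S. \<forall>(u, w)\<in>joined ends A. c u = c w}))
      = (\<Sum>A\<in>Pow E. \<Sum>c\<in>S. (- 1) ^ card A * (\<Prod>e\<in>A. of_bool (monochromatic c e)))"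
    unfolding count constant_on_joined_iff sum_distrib_left
    by (intro sum.cong refl) (simp add: all finite_edge_subset)
  also have "\<dots> = (\<Sum>c\<in>S. \<Sum>A\<in>Pow E. (- 1) ^ card A * (\<Prod>e\<in>A. of_bool (monochromatic c e)))"
    by (rule sum.swap)
  \<comment> \<open>Expanding the product chooses 1 or the negated indicator at each edge;
    \<open>A\<close> is the set of edges where the indicator is chosen.\<close>
  also have "\<dots> = (\<Sum>c\<in>S. \<Prod>e\<in>E. 1 - of_bool (monochromatic c e))"
    by (simp add: prod_diff_conv_sum finite_E)
  also have "\<dots> = (\<Sum>c\<in>S. of_bool (\<forall>e\<in>E. \<not> monochromatic c e))"
    unfolding of_bool_not_iff[symmetric] all[OF finite_E] ..
  also have "\<dots> = int (card {c \<in> S. \<forall>(u, w)\<in>joined ends E. c u \<noteq> c w})"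
    unfolding count proper_on_joined_iff ..
  finally show ?thesis .
qed

end

text \<open>A colour from a list is already in the ground set, so the count does not depend on
  \<open>\<L>\<close>.\<close>

lemma list_colorings_eq:
  assumes "\<And>v. v \<in> V \<Longrightarrow> L v \<subseteq> \<L>"
  shows "list_colorings V E ends \<L> L = {c \<in> Pi\<^sub>E V L. \<forall>(u, w)\<in>joined ends E. c u \<noteq> c w}"
  unfolding list_colorings_def PiE_iff using assms by blast

theorem theorem3p2:
  fixes V :: "'v set" and E :: "'e set" and ends :: "'e \<Rightarrow> 'v set"
    and \<L> :: "'c set" and L :: "'v \<Rightarrow> 'c set"
  assumes "finite_multigraph V E ends"
    and "\<And>v. v \<in> V \<Longrightarrow> finite (L v) \<and> L v \<subseteq> \<L>"
  shows "eval_mpoly (\<lambda>l. int (card l)) (list_chromatic_poly V E ends L)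
       = int (card (list_colorings V E ends \<L> L))"
proof -
  interpret finite_multigraph V E ends by fact
  \<comment> \<open>Finiteness of the lists enters here: it allows cardinalities to be written as
    sums of indicators over all colourings from the lists.\<close>
  have "finite (Pi\<^sub>E V L)"
    using assms(2) finite_V by (intro finite_PiE) auto
  have "eval_mpoly (\<lambda>l. int (card l)) (list_chromatic_poly V E ends L)
      = (\<Sum>A\<in>Pow E. (- 1) ^ card A * (\<Prod>C\<in>components V ends A. int (card (\<Inter>v\<in>C. L v))))"
    by (simp add: list_chromatic_poly_def eval_mpoly_sum eval_mpoly_mult eval_mpoly_sign
        eval_mpoly_prod)
  also have "\<dots> = (\<Sum>A\<in>Pow E. (- 1) ^ card A
      * int (card {c \<in> Pi\<^sub>E V L. \<forall>(u, w)\<in>joined ends A. c u = c w}))"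
    by (intro sum.cong refl) (simp add: card_constant_on_joined)
  also have "\<dots> = int (card {c \<in> Pi\<^sub>E V L. \<forall>(u, w)\<in>joined ends E. c u \<noteq> c w})"
    using \<open>finite (Pi\<^sub>E V L)\<close> by (rule alternating_sum_constant_on_joined)
  also have "\<dots> = int (card (list_colorings V E ends \<L> L))"
    using assms(2) by (simp add: list_colorings_eq)
  finally show ?thesis .
qed

end
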